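(* Let $G$ be an $r$-regular graph with $r>1$, $n$ vertices and $m$ edges, and let $\alpha\in[0,1]$. Let $\lambda_1(A_\alpha(G)),\dots,\lambda_n(A_\alpha(G))$ be the eigenvalues of $A_\alpha(G)$. Then $A_\alpha(T(G))$ has $m-n$ eigenvalues equal to $2\alpha(r+1)-2$, and its other $2n$ eigenvalues are $$\frac12\Bigl(2\bigl(\alpha+\lambda_i(A_\alpha(G))-1\bigr)+r(\alpha+1)\pm\sqrt{(\alpha-1)\bigl(\alpha(r+2)^2-r^2-4(1+\lambda_i(A_\alpha(G)))\bigr)}\Bigr),\quad i=1,\dots,n.$$
   Context: For a simple graph $G$ with adjacency matrix $A(G)$ and diagonal degree matrix $D(G)$, $A_\alpha(G)=\alpha D(G)+(1-\alpha)A(G)$. The total graph $T(G)$ has as vertices the vertices and edges of $G$, two of them being adjacent iff the corresponding elements of $G$ are adjacent (two vertices joined by an edge, or two edges sharing an endpoint) or incident (a vertex and an edge containing it). *)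

theory Defs
  imports
    "Jordan_Normal_Form.Char_Poly"
begin

text \<open>
  An undirected graph is a pair of a vertex set and a set of unordered pairs of vertices.
\<close>

type_synonym 'a ugraph = "'a set \<times> 'a set set"

abbreviation vertices :: "'a ugraph \<Rightarrow> 'a set" where
  "vertices G \<equiv> fst G"

abbreviation edges :: "'a ugraph \<Rightarrow> 'a set set" where
  "edges G \<equiv> snd G"

definition simple_graph :: "'a ugraph \<Rightarrow> bool" where
  "simple_graph G \<longleftrightarrow>
     finite (vertices G) \<and> (\<forall>e\<in>edges G. e \<subseteq> vertices G \<and> card e = 2)"

definition adjacent :: "'a ugraph \<Rightarrow> 'a \<Rightarrow> 'a \<Rightarrow> bool" where
  "adjacent G u v \<longleftrightarrow> {u, v} \<in> edges G"

definition degree_of :: "'a ugraph \<Rightarrow> 'a \<Rightarrow> nat" where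
  "degree_of G v = card {u \<in> vertices G. adjacent G u v}"

definition regular_graph :: "nat \<Rightarrow> 'a ugraph \<Rightarrow> bool" where
  "regular_graph r G \<longleftrightarrow> simple_graph G \<and> (\<forall>v\<in>vertices G. degree_of G v = r)"

fun total_adjacent :: "'a ugraph \<Rightarrow> 'a + 'a set \<Rightarrow> 'a + 'a set \<Rightarrow> bool" where
  "total_adjacent G (Inl u) (Inl v) \<longleftrightarrow> adjacent G u v"
| "total_adjacent G (Inr e) (Inr f) \<longleftrightarrow> e \<noteq> f \<and> e \<inter> f \<noteq> {}"
| "total_adjacent G (Inl v) (Inr e) \<longleftrightarrow> v \<in> e"
| "total_adjacent G (Inr e) (Inl v) \<longleftrightarrow> v \<in> e"

definition total_graph :: "'a ugraph \<Rightarrow> ('a + 'a set) ugraph" where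
  "total_graph G =
     (vertices G <+> edges G,
      {{x, y} | x y. x \<in> vertices G <+> edges G \<and> y \<in> vertices G <+> edges G \<and>
                     total_adjacent G x y})"

text \<open>
  A matrix of a graph refers to an enumeration of the vertices: in the matrices below, row and
  column \<open>i\<close> belong to the vertex \<open>vs ! i\<close>.
\<close>

definition enumerates :: "'a list \<Rightarrow> 'a set \<Rightarrow> bool" where
  "enumerates vs V \<longleftrightarrow> distinct vs \<and> set vs = V"

definition adjacency_mat :: "'a ugraph \<Rightarrow> 'a list \<Rightarrow> real mat" where
  "adjacency_mat G vs =
     mat (length vs) (length vs) (\<lambda>(i, j). if adjacent G (vs ! i) (vs ! j) then 1 else 0)"

definition degree_mat :: "'a ugraph \<Rightarrow> 'a list \<Rightarrow> real mat" where
  "degree_mat G vs =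
     mat (length vs) (length vs) (\<lambda>(i, j). if i = j then real (degree_of G (vs ! i)) else 0)"

definition A_alpha :: "real \<Rightarrow> 'a ugraph \<Rightarrow> 'a list \<Rightarrow> real mat" where
  "A_alpha \<alpha> G vs = \<alpha> \<cdot>\<^sub>m degree_mat G vs + (1 - \<alpha>) \<cdot>\<^sub>m adjacency_mat G vs"

text \<open>
  The eigenvalues with their algebraic multiplicities. Only roots in the field of the entries are
  counted, so the multiset has \<open>dim_row M\<close> elements only if the characteristic polynomial
  splits there; for a real symmetric matrix it does, see \<open>size_eigenvalues_symmetric\<close> below.
\<close>

definition eigenvalues :: "'a :: field mat \<Rightarrow> 'a multiset" where
  "eigenvalues M = proots (char_poly M)"


lemma symmetric_eigenvalue_real:
  fixes M :: "real mat"
  assumes M: "M \<in> carrier_mat k k" and sym: "transpose_mat M = M"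
    and ev: "eigenvalue (map_mat complex_of_real M) a"
  shows "a \<in> \<real>"
proof -
  let ?C = "map_mat complex_of_real M"
  have C: "?C \<in> carrier_mat k k" using M by auto
  have symE: "M $$ (i, j) = M $$ (j, i)" if "i < k" "j < k" for i j
    using arg_cong[OF sym, of "\<lambda>X. X $$ (i, j)"] that M by simp
  obtain v where v: "v \<in> carrier_vec k" "v \<noteq> 0\<^sub>v k" "?C *\<^sub>v v = a \<cdot>\<^sub>v v"
    using ev C unfolding eigenvalue_def eigenvector_def by auto
  have row: "(\<Sum>j<k. complex_of_real (M $$ (i, j)) * v $ j) = a * v $ i" if "i < k" for i
    using arg_cong[OF v(3), of "\<lambda>w. w $ i"] that v(1) M
    by (simp add: scalar_prod_def atLeast0LessThan)
  define S where "S = (\<Sum>i<k. cnj (v $ i) * v $ i)"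
  define Q where "Q = (\<Sum>i<k. \<Sum>j<k. cnj (v $ i) * (complex_of_real (M $$ (i, j)) * v $ j))"
  have Q: "Q = a * S"
    unfolding Q_def S_def sum_distrib_left
    by (rule sum.cong) (auto simp: sum_distrib_left[symmetric] row)
  have "cnj Q = (\<Sum>i<k. \<Sum>j<k. v $ i * (complex_of_real (M $$ (i, j)) * cnj (v $ j)))"
    unfolding Q_def by simp
  also have "\<dots> = (\<Sum>j<k. \<Sum>i<k. v $ i * (complex_of_real (M $$ (i, j)) * cnj (v $ j)))"
    by (rule sum.swap)
  also have "\<dots> = Q" unfolding Q_def
    by (intro sum.cong refl) (simp add: symE mult_ac)
  finally have cQ: "cnj Q = Q" .
  have S: "S = complex_of_real (\<Sum>i<k. (cmod (v $ i))\<^sup>2)"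
    unfolding S_def of_real_sum
    by (rule sum.cong) (simp_all add: complex_norm_square[symmetric] mult.commute del: of_real_power)
  obtain i where i: "i < k" "v $ i \<noteq> 0" using v by (metis eq_vecI carrier_vecD index_zero_vec)
  have "(\<Sum>i<k. (cmod (v $ i))\<^sup>2) > 0"
    by (rule sum_pos2[of _ i]) (use i in auto)
  hence S0: "S \<noteq> 0" unfolding S by (metis less_irrefl of_real_eq_0_iff)
  have cS: "cnj S = S" unfolding S by simp
  have "cnj a * S = a * S" using cQ cS unfolding Q by (metis complex_cnj_mult)
  hence "cnj a = a" using S0 by simp
  thus ?thesis by (simp add: Reals_cnj_iff)
qed

lemma size_eigenvalues_symmetric:
  fixes M :: "real mat"
  assumes M: "M \<in> carrier_mat k k" and sym: "transpose_mat M = M"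
  shows "size (eigenvalues M) = k"
proof -
  let ?C = "map_mat complex_of_real M"
  have C: "?C \<in> carrier_mat k k" using M by auto
  obtain as where as: "char_poly ?C = (\<Prod>a\<leftarrow>as. [:- a, 1:])" "length as = k"
    using char_poly_factorized[OF C] by blast
  have "a \<in> \<real>" if "a \<in> set as" for a
  proof (rule symmetric_eigenvalue_real[OF M sym])
    show "eigenvalue ?C a"
      using that by (simp add: eigenvalue_root_char_poly[OF C] as(1) poly_prod_list
        prod_list_zero_iff image_iff)
  qed
  hence re: "as = map complex_of_real (map Re as)"
    by (intro nth_equalityI) (auto simp: nth_mem)
  interpret H: map_poly_inj_idom_hom complex_of_real ..
  have "map_poly complex_of_real (char_poly M) = char_poly ?C"
    by (metis M of_real_hom.char_poly_hom)
  also have "\<dots> = map_poly complex_of_real (\<Prod>b\<leftarrow>map Re as. [:- b, 1:])"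
    unfolding as(1) by (subst re) (simp add: H.hom_prod_list o_def)
  finally have p: "char_poly M = (\<Prod>b\<leftarrow>map Re as. [:- b, 1:])"
    by (simp only: H.eq_iff)
  have "proots (\<Prod>b\<leftarrow>bs. [:- b, 1 :: real:]) = mset bs" for bs
  proof (induction bs)
    case (Cons b bs)
    have "(\<Prod>b\<leftarrow>bs. [:- b, 1 :: real:]) \<noteq> 0" by (auto simp: prod_list_zero_iff)
    thus ?case using Cons by (simp add: proots_mult del: mult_pCons_left)
  qed simp
  thus ?thesis by (simp only: eigenvalues_def p size_mset length_map as(2))
qed

lemma size_eigenvalues_A_alpha: "size (eigenvalues (A_alpha \<alpha> G vs)) = length vs"
proof (rule size_eigenvalues_symmetric)
  show "A_alpha \<alpha> G vs \<in> carrier_mat (length vs) (length vs)"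
    by (simp add: A_alpha_def degree_mat_def adjacency_mat_def)
  show "transpose_mat (A_alpha \<alpha> G vs) = A_alpha \<alpha> G vs"
    by (rule eq_matI)
      (auto simp: A_alpha_def degree_mat_def adjacency_mat_def adjacent_def insert_commute)
qed

end

theory Submission imports Defs begin

text \<open>
  Let \<open>B\<close> be the incidence matrix of \<open>G\<close> and \<open>K = A\<^sub>\<alpha>(G)\<close>. The total graph is
  \<open>2r\<close>-regular, and its adjacency matrix has the blocks \<open>A(G)\<close>, \<open>B\<close>, \<open>B\<^sup>T\<close> and \<open>B\<^sup>T B - 2\<close>, where
  \<open>B B\<^sup>T = A(G) + r\<close>. Block elimination therefore expresses the characteristic polynomial \<open>\<chi>(y)\<close> of
  \<open>A\<^sub>\<alpha>(T(G))\<close> through the determinant of a quadratic polynomial in \<open>K\<close>: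
  \<open>w\<^sup>n \<chi>(y) = w\<^sup>m det(K\<^sup>2 + p K + q)\<close> with \<open>w = y - (2\<alpha>(r + 1) - 2)\<close> and with \<open>p\<close>, \<open>q\<close> depending on \<open>y\<close>.
  For large \<open>y\<close> the quadratic splits over the reals, so the determinant is a product of two values of
  the characteristic polynomial of \<open>K\<close>, that is \<open>\<Prod>\<^sub>i (\<lambda>\<^sub>i\<^sup>2 + p \<lambda>\<^sub>i + q)\<close>. As a polynomial in \<open>y\<close>,
  each factor is a quadratic with the two claimed roots.
\<close>

section \<open>Characteristic polynomials under reordering of the vertices\<close>

lemma poly_char_poly:
  fixes A :: "'a :: field mat"
  assumes "A \<in> carrier_mat n n"
  shows "poly (char_poly A) k = det (k \<cdot>\<^sub>m 1\<^sub>m n - A)"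
  unfolding char_poly_matrix[OF assms]
  by (rule arg_cong[of _ _ det]) (use assms in \<open>auto simp: char_matrix_def\<close>)

text \<open>Rows are permuted twice, with a transposition in between, so the sign of
  \<open>p\<close> enters twice and cancels.\<close>

lemma det_permute_rows_cols:
  fixes A :: "'a :: comm_ring_1 mat"
  assumes A: "A \<in> carrier_mat n n" and p: "p permutes {0..<n}"
  shows "det (mat n n (\<lambda>(i, j). A $$ (p i, p j))) = det A"
proof -
  have lt: "p i < n" if "i < n" for i
    using permutes_in_image[OF p] that by simp
  define B where "B = transpose_mat (mat n n (\<lambda>(i, j). A $$ (p i, j)))"
  have B: "B \<in> carrier_mat n n" by (simp add: B_def)
  have "mat n n (\<lambda>(i, j). A $$ (p i, p j)) = transpose_mat (mat n n (\<lambda>(i, j). B $$ (p i, j)))"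
    by (rule eq_matI) (auto simp: B_def lt)
  then have "det (mat n n (\<lambda>(i, j). A $$ (p i, p j))) = det (mat n n (\<lambda>(i, j). B $$ (p i, j)))"
    by (simp add: det_transpose[of _ n])
  also have "\<dots> = signof p * det B" by (rule det_permute_rows[OF B p])
  also have "det B = signof p * det A"
    using det_permute_rows[OF A p] unfolding B_def by (subst det_transpose) auto
  finally show ?thesis
    by (cases p rule: sign_cases) simp_all
qed

text \<open>Applying the same \<open>p\<close> to rows and columns keeps diagonal entries on the
  diagonal, so it commutes with passing to the characteristic matrix.\<close>

lemma char_poly_permute:
  fixes A :: "'a :: comm_ring_1 mat"
  assumes A: "A \<in> carrier_mat n n" and p: "p permutes {0..<n}"
  shows "char_poly (mat n n (\<lambda>(i, j). A $$ (p i, p j))) = char_poly A"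
proof -
  have lt: "p i < n" if "i < n" for i
    using permutes_in_image[OF p] that by simp
  have inj: "p i = p j \<longleftrightarrow> i = j" for i j
    using permutes_inj[OF p] by (auto simp: inj_def)
  have "char_poly_matrix (mat n n (\<lambda>(i, j). A $$ (p i, p j)))
      = mat n n (\<lambda>(i, j). char_poly_matrix A $$ (p i, p j))"
    using A by (intro eq_matI) (auto simp: char_poly_matrix_def lt inj)
  then show ?thesis
    unfolding char_poly_def using A p by (simp add: det_permute_rows_cols)
qed

lemma A_alpha_carrier [simp]: "A_alpha \<alpha> G vs \<in> carrier_mat (length vs) (length vs)"
  by (simp add: A_alpha_def degree_mat_def adjacency_mat_def)

lemma A_alpha_index:
  assumes "i < length vs" "j < length vs"
  shows "A_alpha \<alpha> G vs $$ (i, j) =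
    \<alpha> * (if i = j then real (degree_of G (vs ! i)) else 0)
    + (1 - \<alpha>) * (if adjacent G (vs ! i) (vs ! j) then 1 else 0)"
  using assms by (simp add: A_alpha_def degree_mat_def adjacency_mat_def)

text \<open>Allows an arbitrary enumeration of the total graph to be replaced by one that lists all
  vertices of \<open>G\<close> before all edges, for which the matrix has visible blocks.\<close>

lemma char_poly_A_alpha_enumerates:
  assumes "enumerates vs V" "enumerates us V"
  shows "char_poly (A_alpha \<alpha> G us) = char_poly (A_alpha \<alpha> G vs)"
proof -
  let ?n = "length vs"
  have "mset us = mset vs"
    using assms set_eq_iff_mset_eq_distinct[of us vs] by (simp add: enumerates_def)
  then obtain p where p: "p permutes {..<?n}" "permute_list p vs = us"
    by (rule mset_eq_permutation)
  have len: "length us = ?n" using p by auto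
  have lt: "p i < ?n" if "i < ?n" for i
    using permutes_in_image[OF p(1)] that by simp
  have inj: "p i = p j \<longleftrightarrow> i = j" for i j
    using permutes_inj[OF p(1)] by (auto simp: inj_def)
  have "us ! i = vs ! p i" if "i < ?n" for i
    using permute_list_nth[OF p(1) that] p(2) by simp
  then have "A_alpha \<alpha> G us = mat ?n ?n (\<lambda>(i, j). A_alpha \<alpha> G vs $$ (p i, p j))"
    by (intro eq_matI) (auto simp: A_alpha_index len lt inj carrier_matD[OF A_alpha_carrier])
  then show ?thesis
    using char_poly_permute[OF A_alpha_carrier, of p vs] p(1) by (simp add: lessThan_atLeast0)
qed

section \<open>Determinants of block matrices and of quadratics in a matrix\<close>

text \<open>
  Subtracting \<open>B\<^sup>T\<close> times the first block row from the second turns the lower right block into the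
  scalar matrix \<open>w \<cdot> 1\<close>. Stating the result with both sides multiplied by powers of \<open>w\<close> avoids
  inverting it.
\<close>

lemma det_gram_block:
  fixes X B :: "'a :: field mat"
  assumes X: "X \<in> carrier_mat n n" and B: "B \<in> carrier_mat n m"
  shows "w ^ n * det (four_block_mat X (- b \<cdot>\<^sub>m B) (- b \<cdot>\<^sub>m transpose_mat B)
      (w \<cdot>\<^sub>m 1\<^sub>m m - b \<cdot>\<^sub>m (transpose_mat B * B)))
    = w ^ m * det (w \<cdot>\<^sub>m X - b \<cdot>\<^sub>m (B * transpose_mat B) * (X + b \<cdot>\<^sub>m 1\<^sub>m n))"
proof -
  let ?T = "transpose_mat B" and ?Y = "X + b \<cdot>\<^sub>m 1\<^sub>m n"
  let ?G = "w \<cdot>\<^sub>m 1\<^sub>m m - b \<cdot>\<^sub>m (?T * B)"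
  let ?M = "four_block_mat X (- b \<cdot>\<^sub>m B) (- b \<cdot>\<^sub>m ?T) ?G"
  let ?L = "four_block_mat (1\<^sub>m n) (0\<^sub>m n m) (- ?T) (1\<^sub>m m)"
  \<comment> \<open>Right multiplication by \<open>?R\<close> scales the first block column by
    \<open>w\<close> and adds the second one times \<open>?T * ?Y\<close>. This clears the lower
    left block of \<open>?L * ?M\<close>, which is \<open>- (?T * ?Y)\<close>, without dividing by
    \<open>w\<close>; the price is the factor \<open>w ^ n\<close>.\<close>
  let ?R = "four_block_mat (w \<cdot>\<^sub>m 1\<^sub>m n) (0\<^sub>m n m) (?T * ?Y) (1\<^sub>m m)"
  let ?S = "w \<cdot>\<^sub>m X - b \<cdot>\<^sub>m (B * ?T) * ?Y"
  have T: "?T \<in> carrier_mat m n" and Y: "?Y \<in> carrier_mat n n" using X B by auto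
  have TY: "?T * ?Y = ?T * X + b \<cdot>\<^sub>m ?T"
    using X T by (simp add: mult_add_distrib_mat[OF T X] mult_smult_distrib[OF T one_carrier_mat])
  have LM: "?L * ?M = four_block_mat X (- b \<cdot>\<^sub>m B) (- (?T * ?Y)) (w \<cdot>\<^sub>m 1\<^sub>m m)"
  proof (subst mult_four_block_mat[of _ n n _ m _ m _ _ n _ m], goal_cases)
    case 9
    show ?case
    proof (rule cong_four_block_mat)
      show "1\<^sub>m n * X + 0\<^sub>m n m * (- b \<cdot>\<^sub>m ?T) = X" using X T by simp
      show "1\<^sub>m n * (- b \<cdot>\<^sub>m B) + 0\<^sub>m n m * ?G = - b \<cdot>\<^sub>m B" using B T by simp
      show "- ?T * X + 1\<^sub>m m * (- b \<cdot>\<^sub>m ?T) = - (?T * ?Y)"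
        unfolding TY using X T by (auto intro!: eq_matI)
      have "- ?T * (- b \<cdot>\<^sub>m B) = b \<cdot>\<^sub>m (?T * B)"
        using B T by (auto intro!: eq_matI)
      then show "- ?T * (- b \<cdot>\<^sub>m B) + 1\<^sub>m m * ?G = w \<cdot>\<^sub>m 1\<^sub>m m"
        using B T by (auto intro!: eq_matI)
    qed
  qed (use X B T in auto)
  have LMR: "?L * ?M * ?R = four_block_mat ?S (- b \<cdot>\<^sub>m B) (0\<^sub>m m n) (w \<cdot>\<^sub>m 1\<^sub>m m)"
    unfolding LM
  proof (subst mult_four_block_mat[of _ n n _ m _ m _ _ n _ m], goal_cases)
    case 9
    show ?case
    proof (rule cong_four_block_mat)
      have "(- b \<cdot>\<^sub>m B) * (?T * ?Y) = - (b \<cdot>\<^sub>m (B * ?T) * ?Y)"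
        using X B T Y by (simp add: assoc_mult_mat[OF B T Y] mult_smult_assoc_mat[OF B]
          mult_smult_assoc_mat[of _ n n _ n], auto intro!: eq_matI)
      then show "X * (w \<cdot>\<^sub>m 1\<^sub>m n) + (- b \<cdot>\<^sub>m B) * (?T * ?Y) = ?S"
        using X B T Y by (simp add: mult_smult_distrib[OF X], auto intro!: eq_matI)
      show "X * 0\<^sub>m n m + (- b \<cdot>\<^sub>m B) * 1\<^sub>m m = - b \<cdot>\<^sub>m B" using X B by simp
      show "- (?T * ?Y) * (w \<cdot>\<^sub>m 1\<^sub>m n) + w \<cdot>\<^sub>m 1\<^sub>m m * (?T * ?Y) = 0\<^sub>m m n"
        using T Y by (simp add: mult_smult_distrib[of _ m n _ n] mult_smult_assoc_mat[of _ m m _ n],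
          auto intro!: eq_matI)
      show "- (?T * ?Y) * 0\<^sub>m n m + w \<cdot>\<^sub>m 1\<^sub>m m * 1\<^sub>m m = w \<cdot>\<^sub>m 1\<^sub>m m"
        using T Y by (simp add: mult_smult_assoc_mat[of _ m m _ m])
    qed
  qed (use X B T Y in auto)
  have dL: "det ?L = 1" 
    by (subst det_four_block_mat_upper_right_zero[of _ n _ m]) (use T in auto)
  have dR: "det ?R = w ^ n"
    by (subst det_four_block_mat_upper_right_zero[of _ n _ m]) (use T Y in auto)
  have cL: "?L \<in> carrier_mat (n + m) (n + m)" and cM: "?M \<in> carrier_mat (n + m) (n + m)"
    and cR: "?R \<in> carrier_mat (n + m) (n + m)"
    using X B T by auto
  have "det (?L * ?M * ?R) = w ^ n * det ?M"
    by (simp add: det_mult[OF mult_carrier_mat[OF cL cM] cR] det_mult[OF cL cM] dL dR)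
  moreover have "det (?L * ?M * ?R) = w ^ m * det ?S"
    unfolding LMR by (subst det_four_block_mat_lower_left_zero[of _ n _ m]) (use X B T Y in auto)
  ultimately show ?thesis by simp
qed

text \<open>Serves twice: to expand the determinant left by the elimination into a quadratic in
  \<open>K\<close>, and to factor such a quadratic.\<close>

lemma mult_affine_mat:
  fixes K :: "'a :: comm_ring_1 mat"
  assumes K: "K \<in> carrier_mat n n"
  shows "(a \<cdot>\<^sub>m 1\<^sub>m n + c \<cdot>\<^sub>m K) * (b \<cdot>\<^sub>m 1\<^sub>m n + d \<cdot>\<^sub>m K)
    = (a * b) \<cdot>\<^sub>m 1\<^sub>m n + (a * d + b * c) \<cdot>\<^sub>m K + (c * d) \<cdot>\<^sub>m (K * K)"
  using K
  by (simp add: mult_add_distrib_mat[of _ n n _ n] add_mult_distrib_mat[of _ n n _ _ n]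
      mult_smult_assoc_mat[of _ n n _ n] mult_smult_distrib[of _ n n _ n])
    (auto intro!: eq_matI simp: algebra_simps simp del: index_mult_mat(1))

text \<open>By \<open>disc\<close> the roots \<open>a\<close> and \<open>b\<close> of the quadratic
  are real, so it factors as (a - K)(b - K) within real matrices. The determinant is then the
  characteristic polynomial at \<open>a\<close> times that at \<open>b\<close>, and the factors are
  regrouped by \<open>i\<close>.\<close>

lemma det_monic_quadratic_mat:
  fixes K :: "real mat"
  assumes K: "K \<in> carrier_mat n n" and cp: "char_poly K = (\<Prod>i\<in>I. [:- ev i, 1:])"
    and disc: "4 * q \<le> p\<^sup>2"
  shows "det (q \<cdot>\<^sub>m 1\<^sub>m n + p \<cdot>\<^sub>m K + K * K) = (\<Prod>i\<in>I. (ev i)\<^sup>2 + p * ev i + q)"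
proof -
  define s where "s = sqrt (p\<^sup>2 - 4 * q)"
  define a b where "a = (- p + s) / 2" and "b = (- p - s) / 2"
  have s2: "s\<^sup>2 = p\<^sup>2 - 4 * q" using disc by (simp add: s_def)
  have sum: "a + b = - p" by (simp add: a_def b_def field_simps)
  have "a * b = (p\<^sup>2 - s\<^sup>2) / 4" by (simp add: a_def b_def field_simps power2_eq_square)
  then have prod: "a * b = q" by (simp add: s2)
  have p: "p = - a - b" using sum by simp
  have "q \<cdot>\<^sub>m 1\<^sub>m n + p \<cdot>\<^sub>m K + K * K
      = (a \<cdot>\<^sub>m 1\<^sub>m n + (- 1) \<cdot>\<^sub>m K) * (b \<cdot>\<^sub>m 1\<^sub>m n + (- 1) \<cdot>\<^sub>m K)"
    unfolding mult_affine_mat[OF K] prod using K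
    by (auto intro!: eq_matI simp: p algebra_simps simp del: index_mult_mat(1))
  also have "\<dots> = (a \<cdot>\<^sub>m 1\<^sub>m n - K) * (b \<cdot>\<^sub>m 1\<^sub>m n - K)"
    using K by (intro arg_cong2[of _ _ _ _ "(*)"]) auto
  also have "det \<dots> = poly (char_poly K) a * poly (char_poly K) b"
    using K by (simp add: det_mult[of _ n] poly_char_poly[OF K] minus_carrier_mat)
  also have "\<dots> = (\<Prod>i\<in>I. (a - ev i) * (b - ev i))"
    by (simp add: cp poly_prod prod.distrib)
  also have "\<dots> = (\<Prod>i\<in>I. (ev i)\<^sup>2 + p * ev i + q)"
  proof (rule prod.cong[OF refl])
    fix i
    have "(a - ev i) * (b - ev i) = (ev i)\<^sup>2 - (a + b) * ev i + a * b"
      by (simp add: algebra_simps power2_eq_square)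
    then show "(a - ev i) * (b - ev i) = (ev i)\<^sup>2 + p * ev i + q"
      by (simp add: sum prod)
  qed
  finally show ?thesis .
qed

section \<open>Polynomials as products over their roots\<close>

text \<open>Dividing by a linear factor lowers both the degree and the number of roots by exactly
  one, so the hypothesis passes to the quotient.\<close>

lemma poly_eq_prod_proots:
  fixes p :: "'a :: field poly"
  assumes "size (proots p) = degree p"
  shows "p = Polynomial.smult (lead_coeff p) (\<Prod>x\<in>#proots p. [:- x, 1:])"
  using assms
proof (induction "degree p" arbitrary: p)
  case 0
  then show ?case by (auto elim!: degree_eq_zeroE)
next
  case (Suc d)
  then obtain x where "x \<in># proots p" by (metis size_eq_Suc_imp_elem)
  moreover have p0: "p \<noteq> 0" using Suc.hyps(2) by auto
  ultimately have "poly p x = 0" by simp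
  then obtain q where pq: "p = [:- x, 1:] * q" by (auto simp: poly_eq_0_iff_dvd elim: dvdE)
  with p0 have q0: "q \<noteq> 0" by auto
  have deg: "degree p = Suc (degree q)"
    unfolding pq using q0 by (subst degree_mult_eq) auto
  have roots: "proots p = {#x#} + proots q"
    unfolding pq using q0 by (subst proots_mult) auto
  have q: "q = Polynomial.smult (lead_coeff q) (\<Prod>x\<in>#proots q. [:- x, 1:])"
    by (rule Suc.hyps(1)) (use deg roots Suc in auto)
  have lead: "lead_coeff p = lead_coeff q"
    unfolding pq by (simp only: lead_coeff_mult) simp
  have "p = [:- x, 1:] * Polynomial.smult (lead_coeff q) (\<Prod>x\<in>#proots q. [:- x, 1:])"
    using pq q by simp
  then show ?case
    unfolding roots lead by (simp only: mult_smult_right image_mset_union image_mset_single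
        prod_mset_Un prod_mset_singleton)
qed

lemma char_poly_eq_prod_eigenvalues:
  fixes M :: "'a :: field mat"
  assumes M: "M \<in> carrier_mat n n" and size: "size (eigenvalues M) = n"
  shows "char_poly M = (\<Prod>x\<in>#eigenvalues M. [:- x, 1:])"
  using poly_eq_prod_proots[of "char_poly M"] degree_monic_char_poly[OF M] size
  by (simp add: eigenvalues_def)

section \<open>Counting incidences in regular graphs\<close>

lemma sum_nth_distinct:
  assumes "distinct xs"
  shows "(\<Sum>i = 0..<length xs. f (xs ! i)) = (\<Sum>x\<in>set xs. f x)"
  using sum_list_distinct_conv_sum_set[OF assms, of f] by (simp add: sum_list_sum_nth)

lemma finite_edges:
  assumes "simple_graph G"
  shows "finite (edges G)"
  by (rule finite_subset[of _ "Pow (vertices G)"]) (use assms in \<open>auto simp: simple_graph_def\<close>)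

text \<open>A neighbour \<open>u\<close> corresponds to the edge \<open>{u, v}\<close>; this is onto
  because every edge has exactly two elements.\<close>

lemma degree_of_eq_card_edges:
  assumes G: "simple_graph G"
  shows "degree_of G v = card {e \<in> edges G. v \<in> e}"
proof -
  have E: "e \<subseteq> vertices G" "card e = 2" if "e \<in> edges G" for e
    using G that by (auto simp: simple_graph_def)
  have "bij_betw (\<lambda>u. {u, v}) {u \<in> vertices G. adjacent G u v} {e \<in> edges G. v \<in> e}"
  proof (rule bij_betw_imageI)
    show "inj_on (\<lambda>u. {u, v}) {u \<in> vertices G. adjacent G u v}"
      by (auto simp: inj_on_def doubleton_eq_iff)
    show "(\<lambda>u. {u, v}) ` {u \<in> vertices G. adjacent G u v} = {e \<in> edges G. v \<in> e}"
    proof (intro equalityI subsetI)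
      fix e assume e: "e \<in> {e \<in> edges G. v \<in> e}"
      then obtain a b where "e = {a, b}" using e E(2)[of e] by (auto simp: card_2_iff)
      then show "e \<in> (\<lambda>u. {u, v}) ` {u \<in> vertices G. adjacent G u v}"
        using e E[of e] by (auto simp: adjacent_def insert_commute)
    qed (auto simp: adjacent_def)
  qed
  then show ?thesis unfolding degree_of_def by (rule bij_betw_same_card)
qed

text \<open>Double counting of incidences. With \<open>X\<close> the whole vertex set it yields the
  handshake identity, with \<open>X\<close> an edge it yields the degree of that edge in the total
  graph.\<close>

lemma sum_degree_of:
  assumes G: "simple_graph G" and X: "finite X"
  shows "(\<Sum>v\<in>X. degree_of G v) = (\<Sum>e\<in>edges G. card (X \<inter> e))"
proof -
  have "(\<Sum>v\<in>X. degree_of G v) = (\<Sum>v\<in>X. \<Sum>e\<in>edges G. of_bool (v \<in> e))"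
    by (simp add: degree_of_eq_card_edges[OF G] finite_edges[OF G] Collect_conj_eq)
  also have "\<dots> = (\<Sum>e\<in>edges G. \<Sum>v\<in>X. of_bool (v \<in> e))" by (rule sum.swap)
  finally show ?thesis using X by simp
qed

lemma regular_handshake:
  assumes "regular_graph r G"
  shows "r * card (vertices G) = 2 * card (edges G)"
proof -
  have G: "simple_graph G" using assms by (simp add: regular_graph_def)
  have "r * card (vertices G) = (\<Sum>v\<in>vertices G. degree_of G v)"
    using assms by (simp add: regular_graph_def)
  also have "\<dots> = (\<Sum>e\<in>edges G. card (vertices G \<inter> e))"
    using G by (intro sum_degree_of) (auto simp: simple_graph_def)
  also have "\<dots> = (\<Sum>e\<in>edges G. 2)"
    using G by (intro sum.cong refl) (auto simp: simple_graph_def Int_absorb1)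
  finally show ?thesis by simp
qed

text \<open>Here r > 1 enters. The inequality makes the natural-number difference
  \<open>m - n\<close> a true difference.\<close>

lemma regular_card_vertices_le_edges:
  assumes "regular_graph r G" and "r > 1"
  shows "card (vertices G) \<le> card (edges G)"
proof -
  have "2 * card (vertices G) \<le> r * card (vertices G)" using assms(2) by simp
  also have "\<dots> = 2 * card (edges G)" by (rule regular_handshake[OF assms(1)])
  finally show ?thesis by simp
qed

section \<open>Adjacency and degrees in the total graph\<close>

text \<open>An edge of the total graph is an unordered pair and forgets which end came first; the
  symmetry of \<open>total_adjacent\<close> makes up for that.\<close>

lemma adjacent_total_graph:
  assumes G: "simple_graph G" and "x \<in> vertices (total_graph G)" "y \<in> vertices (total_graph G)"
  shows "adjacent (total_graph G) x y \<longleftrightarrow> total_adjacent G x y"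
proof -
  have sym: "total_adjacent G a b \<longleftrightarrow> total_adjacent G b a" for a b
    by (cases a; cases b) (auto simp: adjacent_def insert_commute)
  show ?thesis
    using assms(2,3) sym[of x y] by (auto simp: adjacent_def total_graph_def doubleton_eq_iff)
qed

text \<open>Two distinct two-element sets share at most one element. Off the diagonal, the Gram
  matrix of the edges is therefore the adjacency matrix of the line graph.\<close>

lemma card_edge_Int:
  assumes G: "simple_graph G" and e: "e \<in> edges G" and f: "f \<in> edges G" and ne: "e \<noteq> f"
  shows "card (e \<inter> f) = of_bool (e \<inter> f \<noteq> {})"
proof -
  have c: "card e = 2" "card f = 2" using assms by (auto simp: simple_graph_def)
  have fin: "finite e" "finite f" using c by (auto intro: card_ge_0_finite)
  have "e \<inter> f \<subset> e"
  proof
    show "e \<inter> f \<noteq> e"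
      using ne c fin by (metis card_subset_eq inf.cobounded2)
  qed auto
  then have "card (e \<inter> f) < 2" using c fin psubset_card_mono by metis
  moreover have "card (e \<inter> f) = 0 \<longleftrightarrow> e \<inter> f = {}" using fin by simp
  ultimately show ?thesis by auto
qed

lemma degree_of_total_graph:
  assumes reg: "regular_graph r G" and x: "x \<in> vertices (total_graph G)"
  shows "degree_of (total_graph G) x = 2 * r"
proof -
  have G: "simple_graph G" using reg by (simp add: regular_graph_def)
  let ?V = "vertices G" and ?E = "edges G"
  have finV: "finite ?V" using G by (simp add: simple_graph_def)
  note finE = finite_edges[OF G]
  have VT: "vertices (total_graph G) = ?V <+> ?E" by (simp add: total_graph_def)
  have "{y \<in> vertices (total_graph G). adjacent (total_graph G) y x}
      = {y \<in> vertices (total_graph G). total_adjacent G y x}"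
    using adjacent_total_graph[OF G _ x] by auto
  also have "\<dots> = {u \<in> ?V. total_adjacent G (Inl u) x} <+> {f \<in> ?E. total_adjacent G (Inr f) x}"
    unfolding VT by auto
  finally have *: "degree_of (total_graph G) x
      = card {u \<in> ?V. total_adjacent G (Inl u) x} + card {f \<in> ?E. total_adjacent G (Inr f) x}"
    unfolding degree_of_def using finV finE by (simp add: card_Plus)
  show ?thesis
  proof (cases x)
    case (Inl v)
    then have v: "v \<in> ?V" using x VT by auto
    then have "degree_of G v = r" using reg by (simp add: regular_graph_def)
    then show ?thesis
      using * degree_of_eq_card_edges[OF G, of v] by (simp add: Inl degree_of_def)
  next
    case (Inr e)
    then have e: "e \<in> ?E" using x VT by auto
    then have eV: "e \<subseteq> ?V" and e2: "card e = 2" using G by (auto simp: simple_graph_def)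
    have fine: "finite e" using finV eV finite_subset by blast
    \<comment> \<open>Adding the degrees of the two ends counts \<open>e\<close> itself twice and
      every other edge meeting \<open>e\<close> once. The 2 contributed by \<open>e\<close> equals
      the number of its ends, which are its remaining neighbours in the total graph.\<close>
    have "2 * r = (\<Sum>v\<in>e. degree_of G v)"
      using reg eV e2 by (simp add: regular_graph_def subset_iff)
    also have "\<dots> = (\<Sum>f\<in>?E. card (e \<inter> f))" by (rule sum_degree_of[OF G fine])
    also have "\<dots> = 2 + (\<Sum>f\<in>?E - {e}. card (e \<inter> f))"
      using e e2 by (simp add: sum.remove[OF finE e])
    also have "(\<Sum>f\<in>?E - {e}. card (e \<inter> f)) = (\<Sum>f\<in>?E - {e}. of_bool (e \<inter> f \<noteq> {}))"
      by (intro sum.cong refl card_edge_Int[OF G e]) auto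
    also have "\<dots> = card ((?E - {e}) \<inter> {f. e \<inter> f \<noteq> {}})"
      using finE by simp
    also have "(?E - {e}) \<inter> {f. e \<inter> f \<noteq> {}} = {f \<in> ?E. f \<noteq> e \<and> f \<inter> e \<noteq> {}}" by auto
    finally have "2 + card {f \<in> ?E. f \<noteq> e \<and> f \<inter> e \<noteq> {}} = 2 * r" ..
    moreover have "{u \<in> ?V. u \<in> e} = e" using eV by auto
    ultimately show ?thesis using * e2 by (simp add: Inr)
  qed
qed

section \<open>Gram products of the incidence matrix and the block form\<close>

definition incidence_mat :: "'a list \<Rightarrow> 'a set list \<Rightarrow> real mat" where
  "incidence_mat vs es = mat (length vs) (length es) (\<lambda>(i, j). of_bool (vs ! i \<in> es ! j))"

lemma incidence_mat_carrier [simp]: "incidence_mat vs es \<in> carrier_mat (length vs) (length es)"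
  by (simp add: incidence_mat_def)

lemma incidence_mat_gram_vertices:
  assumes G: "simple_graph G" and es: "enumerates es (edges G)"
    and i: "i < length vs" and j: "j < length vs"
  shows "(incidence_mat vs es * transpose_mat (incidence_mat vs es)) $$ (i, j)
    = card {e \<in> edges G. vs ! i \<in> e \<and> vs ! j \<in> e}"
proof -
  have "(incidence_mat vs es * transpose_mat (incidence_mat vs es)) $$ (i, j)
      = (\<Sum>k = 0..<length es. of_bool (vs ! i \<in> es ! k \<and> vs ! j \<in> es ! k))"
    using i j by (simp add: incidence_mat_def scalar_prod_def of_bool_conj)
  also have "\<dots> = (\<Sum>e\<in>edges G. of_bool (vs ! i \<in> e \<and> vs ! j \<in> e))"
    using es by (subst sum_nth_distinct) (auto simp: enumerates_def)
  finally show ?thesis using finite_edges[OF G] by (simp add: Collect_conj_eq)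
qed

lemma incidence_mat_gram_edges:
  assumes vs: "enumerates vs V" and sub: "\<And>e. e \<in> set es \<Longrightarrow> e \<subseteq> V"
    and i: "i < length es" and j: "j < length es"
  shows "(transpose_mat (incidence_mat vs es) * incidence_mat vs es) $$ (i, j)
    = card (es ! i \<inter> es ! j)"
proof -
  have "(transpose_mat (incidence_mat vs es) * incidence_mat vs es) $$ (i, j)
      = (\<Sum>k = 0..<length vs. of_bool (vs ! k \<in> es ! i \<and> vs ! k \<in> es ! j))"
    using i j by (simp add: incidence_mat_def scalar_prod_def of_bool_conj)
  also have "\<dots> = (\<Sum>v\<in>V. of_bool (v \<in> es ! i \<and> v \<in> es ! j))"
    using vs by (subst sum_nth_distinct) (auto simp: enumerates_def)
  also have "\<dots> = card (V \<inter> (es ! i \<inter> es ! j))"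
    using vs by (auto simp: enumerates_def Collect_conj_eq)
  also have "V \<inter> (es ! i \<inter> es ! j) = es ! i \<inter> es ! j"
    using sub[OF nth_mem[OF i]] by auto
  finally show ?thesis .
qed

text \<open>This is \<open>B B\<^sup>T = A(G) + r\<close> times 1 - \<alpha>, rewritten by (1 -
  \<alpha>) A(G) = \<open>A_alpha \<alpha> G vs\<close> - \<alpha> r. Keeping the factor 1 -
  \<alpha> avoids a division that fails at \<alpha> = 1.\<close>

lemma incidence_mat_gram_regular:
  assumes reg: "regular_graph r G"
    and vs: "enumerates vs (vertices G)" and es: "enumerates es (edges G)"
  shows "(1 - \<alpha>) \<cdot>\<^sub>m (incidence_mat vs es * transpose_mat (incidence_mat vs es))
    = A_alpha \<alpha> G vs + (r * (1 - 2 * \<alpha>)) \<cdot>\<^sub>m 1\<^sub>m (length vs)"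
    (is "?L = ?R")
proof (rule eq_matI)
  have G: "simple_graph G" using reg by (simp add: regular_graph_def)
  fix i j assume "i < dim_row ?R" "j < dim_col ?R"
  then have i: "i < length vs" and j: "j < length vs" by simp_all
  have "vs ! k \<in> vertices G" if "k < length vs" for k
    using nth_mem[OF that] vs by (simp add: enumerates_def)
  then have deg: "degree_of G (vs ! k) = r" if "k < length vs" for k
    using reg that by (simp add: regular_graph_def)
  have "real (card {e \<in> edges G. vs ! i \<in> e \<and> vs ! j \<in> e})
      = (if i = j then r else of_bool (adjacent G (vs ! i) (vs ! j)))"
  proof (cases "i = j")
    case True
    then show ?thesis using deg[OF i] degree_of_eq_card_edges[OF G, of "vs ! i"] by simp
  next
    case False
    then have ne: "vs ! i \<noteq> vs ! j" using vs i j by (simp add: enumerates_def nth_eq_iff_index_eq)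
    \<comment> \<open>Two distinct vertices lie in at most one common edge, so the count is 0 or
      1.\<close>
    have "e = {vs ! i, vs ! j}" if "e \<in> edges G" "vs ! i \<in> e" "vs ! j \<in> e" for e
    proof -
      have e2: "card e = 2" using G that(1) by (simp add: simple_graph_def)
      then have "finite e" by (intro card_ge_0_finite) simp
      from card_subset_eq[OF this, of "{vs ! i, vs ! j}"] show ?thesis
        using that(2,3) ne e2 by simp
    qed
    then have "{e \<in> edges G. vs ! i \<in> e \<and> vs ! j \<in> e} = {{vs ! i, vs ! j}} \<inter> edges G"
      by blast
    then show ?thesis using False by (simp add: adjacent_def)
  qed
  then have L: "?L $$ (i, j) = (1 - \<alpha>) * (if i = j then r else of_bool (adjacent G (vs ! i) (vs ! j)))"
    using i j incidence_mat_gram_vertices[OF G es i j]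
    by (simp add: carrier_matD[OF incidence_mat_carrier] del: index_mult_mat(1))
  have R: "?R $$ (i, j) = A_alpha \<alpha> G vs $$ (i, j) + (if i = j then r * (1 - 2 * \<alpha>) else 0)"
    using i j by (simp add: carrier_matD[OF A_alpha_carrier])
  have irr: "\<not> adjacent G v v" for v
    using G by (auto simp: adjacent_def simple_graph_def)
  show "?L $$ (i, j) = ?R $$ (i, j)"
    unfolding L R A_alpha_index[OF i j] using deg[OF j] irr
    by (cases "i = j") (simp_all add: algebra_simps)
qed (simp_all add: carrier_matD[OF incidence_mat_carrier] carrier_matD[OF A_alpha_carrier])

text \<open>The diagonal of the total graph's matrix is 2 r \<alpha>. In the vertex block half of it
  is absorbed into \<open>A_alpha \<alpha> G vs\<close>; in the edge block the term 2 (1 - \<alpha>)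
  offsets the diagonal entries 2 of \<open>transpose_mat B * B\<close>.\<close>

lemma char_matrix_total_graph:
  fixes \<alpha> y :: real
  assumes reg: "regular_graph r G"
    and vs: "enumerates vs (vertices G)" and es: "enumerates es (edges G)"
  defines "B \<equiv> incidence_mat vs es"
  shows "y \<cdot>\<^sub>m 1\<^sub>m (length vs + length es) - A_alpha \<alpha> (total_graph G) (map Inl vs @ map Inr es)
    = four_block_mat ((y - r * \<alpha>) \<cdot>\<^sub>m 1\<^sub>m (length vs) - A_alpha \<alpha> G vs)
        (- (1 - \<alpha>) \<cdot>\<^sub>m B) (- (1 - \<alpha>) \<cdot>\<^sub>m transpose_mat B)
        ((y - 2 * r * \<alpha> + 2 * (1 - \<alpha>)) \<cdot>\<^sub>m 1\<^sub>m (length es) - (1 - \<alpha>) \<cdot>\<^sub>m (transpose_mat B * B))"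
    (is "?L = ?R")
proof (rule eq_matI)
  let ?ws = "map Inl vs @ map Inr es"
  have G: "simple_graph G" using reg by (simp add: regular_graph_def)
  have dv: "distinct vs" "set vs = vertices G" and de: "distinct es" "set es = edges G"
    using vs es by (auto simp: enumerates_def)
  have B: "B \<in> carrier_mat (length vs) (length es)" by (simp add: B_def)
  fix i j assume "i < dim_row ?R" "j < dim_col ?R"
  then have i: "i < length ?ws" and j: "j < length ?ws"
    using B by (simp_all add: carrier_matD[OF A_alpha_carrier])
  have mem: "?ws ! k \<in> vertices (total_graph G)" if "k < length ?ws" for k
    using nth_mem[OF that] dv de by (auto simp: total_graph_def)
  have T: "A_alpha \<alpha> (total_graph G) ?ws $$ (i, j)
      = \<alpha> * (if i = j then 2 * r else 0) + (1 - \<alpha>) * of_bool (total_adjacent G (?ws ! i) (?ws ! j))"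
    unfolding A_alpha_index[OF i j]
    by (simp add: degree_of_total_graph[OF reg mem[OF i]] degree_of_total_graph[OF reg mem[OF j]]
        adjacent_total_graph[OF G mem[OF i] mem[OF j]])
  have T': "?L $$ (i, j) = y * of_bool (i = j) - A_alpha \<alpha> (total_graph G) ?ws $$ (i, j)"
    using i j by (simp add: carrier_matD[OF A_alpha_carrier])
  have irr: "\<not> adjacent G v v" for v
    using G by (auto simp: adjacent_def simple_graph_def)
  consider (vv) "i < length vs" "j < length vs" | (ve) "i < length vs" "length vs \<le> j"
    | (ev) "length vs \<le> i" "j < length vs" | (ee) "length vs \<le> i" "length vs \<le> j" by linarith
  then show "?L $$ (i, j) = ?R $$ (i, j)"
  proof cases
    case vv
    have "degree_of G (vs ! i) = r" "degree_of G (vs ! j) = r"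
      using reg nth_mem[OF vv(1)] nth_mem[OF vv(2)] dv by (simp_all add: regular_graph_def)
    then show ?thesis
      unfolding T' T using vv irr B
      by (simp add: nth_append A_alpha_index carrier_matD[OF A_alpha_carrier] algebra_simps)
  next
    case ve
    then show ?thesis
      unfolding T' T using i j B
      by (simp add: nth_append carrier_matD[OF A_alpha_carrier] incidence_mat_def B_def)
  next
    case ev
    then show ?thesis
      unfolding T' T using i j B
      by (simp add: nth_append carrier_matD[OF A_alpha_carrier] incidence_mat_def B_def)
  next
    case ee
    let ?i = "i - length vs" and ?j = "j - length vs"
    have ij: "?i < length es" "?j < length es" using ee i j by auto
    have gram: "(transpose_mat B * B) $$ (?i, ?j) = card (es ! ?i \<inter> es ! ?j)"
      unfolding B_def by (rule incidence_mat_gram_edges[OF vs _ ij]) (use G de in \<open>auto simp: simple_graph_def\<close>)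
    have eE: "es ! ?i \<in> edges G" "es ! ?j \<in> edges G" using ij de nth_mem by blast+
    show ?thesis
    proof (cases "i = j")
      case True
      have "card (es ! ?i) = 2" using G eE by (simp add: simple_graph_def)
      then show ?thesis
        unfolding T' T using ee ij i j B gram True
        by (simp add: nth_append carrier_matD[OF A_alpha_carrier] algebra_simps del: index_mult_mat(1))
    next
      case False
      then have "?i \<noteq> ?j" using ee by simp
      moreover then have "es ! ?i \<noteq> es ! ?j" using de ij by (simp add: nth_eq_iff_index_eq)
      ultimately show ?thesis
        unfolding T' T using ee ij i j B gram False card_edge_Int[OF G eE]
        by (simp add: nth_append carrier_matD[OF A_alpha_carrier] del: index_mult_mat(1))
    qed
  qed
qed (simp_all add: carrier_matD[OF A_alpha_carrier] carrier_matD[OF incidence_mat_carrier] B_def)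

section \<open>Real polynomials and roots of quadratics\<close>

text \<open>The difference would have infinitely many roots. It thus suffices to compare
  characteristic polynomials where the quadratic in the matrix splits.\<close>

lemma poly_eq_if_eq_above:
  fixes p q :: "real poly"
  assumes "\<And>x. c \<le> x \<Longrightarrow> poly p x = poly q x"
  shows "p = q"
proof (rule ccontr)
  assume "p \<noteq> q"
  then have "finite {x. poly (p - q) x = 0}" by (intro poly_roots_finite) simp
  moreover have "{c..} \<subseteq> {x. poly (p - q) x = 0}" using assms by auto
  ultimately show False using infinite_Ici finite_subset by blast
qed

text \<open>A real root \<open>x\<close> forces \<open>d = (2 * x - b)\<^sup>2\<close>, hence 0
  \<le> \<open>d\<close>. Without a root the right-hand side would be wrong, since
  \<open>sqrt\<close> is also defined on negative numbers.\<close>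

lemma proots_quadratic:
  fixes b d :: real
  assumes "proots [:(b\<^sup>2 - d) / 4, - b, 1:] \<noteq> {#}"
  shows "proots [:(b\<^sup>2 - d) / 4, - b, 1:] = {#1 / 2 * (b + sqrt d), 1 / 2 * (b - sqrt d)#}"
proof -
  obtain x where "x \<in># proots [:(b\<^sup>2 - d) / 4, - b, 1:]" using assms by blast
  then have "poly [:(b\<^sup>2 - d) / 4, - b, 1:] x = 0" by simp
  then have "d = (2 * x - b)\<^sup>2" by (simp add: power2_eq_square field_simps)
  then have "0 \<le> d" by simp
  then have "[:(b\<^sup>2 - d) / 4, - b, 1:]
      = [:- (1 / 2 * (b + sqrt d)), 1:] * [:- (1 / 2 * (b - sqrt d)), 1:]"
    by (simp add: power2_eq_square field_simps)
  also have "proots \<dots> = {#1 / 2 * (b + sqrt d), 1 / 2 * (b - sqrt d)#}"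
    by (subst proots_mult) (auto simp del: mult_pCons_left mult_pCons_right)
  finally show ?thesis .
qed

lemma size_sum_mset_image:
  fixes f :: "'i \<Rightarrow> 'a multiset"
  shows "size (\<Sum>i\<in>I. f i) = (\<Sum>i\<in>I. size (f i))"
  by (induction I rule: infinite_finite_induct) auto

section \<open>The spectrum of the total graph\<close>

text \<open>The quadratic factors are given by their coefficients, free of \<open>sqrt\<close>, so
  that the identity holds before anything is known about the sign of \<open>d i\<close>.\<close>

lemma char_poly_total_graph:
  fixes \<alpha> :: real and ev :: "'i \<Rightarrow> real"
  assumes reg: "regular_graph r G" and r: "r > 1" and \<alpha>: "0 \<le> \<alpha>" "\<alpha> \<le> 1"
    and vs: "enumerates vs (vertices G)" and es: "enumerates es (edges G)"
    and cp: "char_poly (A_alpha \<alpha> G vs) = (\<Prod>i\<in>I. [:- ev i, 1:])"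
  defines "b \<equiv> \<lambda>i. 2 * (\<alpha> + ev i - 1) + r * (\<alpha> + 1)"
    and "d \<equiv> \<lambda>i. (\<alpha> - 1) * (\<alpha> * (real r + 2)\<^sup>2 - (real r)\<^sup>2 - 4 * (1 + ev i))"
  shows "char_poly (A_alpha \<alpha> (total_graph G) (map Inl vs @ map Inr es))
    = [:- (2 * \<alpha> * (real r + 1) - 2), 1:] ^ (length es - length vs)
      * (\<Prod>i\<in>I. [:((b i)\<^sup>2 - d i) / 4, - b i, 1:])"
proof -
  let ?n = "length vs" and ?m = "length es" and ?\<beta> = "1 - \<alpha>"
  let ?c = "2 * \<alpha> * (real r + 1) - 2"
  let ?K = "A_alpha \<alpha> G vs" and ?M = "A_alpha \<alpha> (total_graph G) (map Inl vs @ map Inr es)"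
  let ?P = "\<Prod>i\<in>I. [:((b i)\<^sup>2 - d i) / 4, - b i, 1:]"
  let ?B = "incidence_mat vs es"
  have len: "?n = card (vertices G)" "?m = card (edges G)"
    using vs es by (auto simp: enumerates_def distinct_card[symmetric])
  have nm: "?n \<le> ?m" using regular_card_vertices_le_edges[OF reg r] len by simp
  have K: "?K \<in> carrier_mat ?n ?n" by simp
  have M: "?M \<in> carrier_mat (?n + ?m) (?n + ?m)"
    using A_alpha_carrier[of \<alpha> "total_graph G" "map Inl vs @ map Inr es"] by simp
  \<comment> \<open>For large \<open>y\<close> the quadratic polynomial in \<open>?K\<close> left by the elimination has real roots.\<close>
  have "poly ([:- ?c, 1:] ^ ?n * char_poly ?M) y = poly ([:- ?c, 1:] ^ ?m * ?P) y"
    if y: "2 * r * \<alpha> \<le> y" for y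
  proof -
    \<comment> \<open>\<open>w\<close> is the scalar left in the edge block and equals
      \<open>y - ?c\<close>; \<open>x\<close> is the shift in the vertex block, and \<open>g\<close>
      comes from the Gram matrix of the vertices. Expanding w (x - K) - (g + K)(x + 1 - \<alpha> -
      K) gives the coefficients \<open>p\<close> and \<open>q\<close>.\<close>
    define w where "w = y - 2 * r * \<alpha> + 2 * ?\<beta>"
    define x where "x = y - r * \<alpha>"
    define g where "g = r * (1 - 2 * \<alpha>)"
    define p where "p = g - w - (x + ?\<beta>)"
    define q where "q = w * x - g * (x + ?\<beta>)"
    let ?X = "x \<cdot>\<^sub>m 1\<^sub>m ?n - ?K"
    have X: "?X \<in> carrier_mat ?n ?n" using K by (simp add: minus_carrier_mat)
    have pos: "0 \<le> 4 * ?\<beta> * (y - 2 * r * \<alpha>)" "0 \<le> ?\<beta>\<^sup>2 * ((real r - 1)\<^sup>2 + 8)"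
      using \<alpha> y by simp_all
    \<comment> \<open>The terms quadratic in \<open>y\<close> cancel. What remains is nonnegative
      once \<open>y\<close> reaches 2 r \<alpha>, which explains the chosen bound.\<close>
    have "p\<^sup>2 - 4 * q = ?\<beta>\<^sup>2 * ((real r - 1)\<^sup>2 + 8) + 4 * ?\<beta> * (y - 2 * r * \<alpha>)"
      by (simp add: p_def q_def w_def x_def g_def power2_eq_square algebra_simps)
    then have disc: "4 * q \<le> p\<^sup>2" using pos by linarith
    have XY: "?X + ?\<beta> \<cdot>\<^sub>m 1\<^sub>m ?n = (x + ?\<beta>) \<cdot>\<^sub>m 1\<^sub>m ?n + (- 1) \<cdot>\<^sub>m ?K"
      using carrier_matD[OF K] by (auto intro!: eq_matI)
    have gram: "?\<beta> \<cdot>\<^sub>m (?B * transpose_mat ?B) = g \<cdot>\<^sub>m 1\<^sub>m ?n + 1 \<cdot>\<^sub>m ?K"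
      unfolding incidence_mat_gram_regular[OF reg vs es] g_def
      using carrier_matD[OF K] by (auto intro!: eq_matI)
    have "w \<cdot>\<^sub>m ?X - ?\<beta> \<cdot>\<^sub>m (?B * transpose_mat ?B) * (?X + ?\<beta> \<cdot>\<^sub>m 1\<^sub>m ?n)
        = q \<cdot>\<^sub>m 1\<^sub>m ?n + p \<cdot>\<^sub>m ?K + ?K * ?K"
      unfolding XY gram mult_affine_mat[OF K] using carrier_matD[OF K]
      by (auto intro!: eq_matI simp: p_def q_def algebra_simps simp del: index_mult_mat(1))
    then have "w ^ ?n * poly (char_poly ?M) y = w ^ ?m * (\<Prod>i\<in>I. (ev i)\<^sup>2 + p * ev i + q)"
      unfolding poly_char_poly[OF M] char_matrix_total_graph[OF reg vs es]
      using det_gram_block[OF X incidence_mat_carrier[of vs es], of w ?\<beta>]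
        det_monic_quadratic_mat[OF K cp disc]
      by (simp add: w_def x_def)
    also have "(\<Prod>i\<in>I. (ev i)\<^sup>2 + p * ev i + q) = poly ?P y"
      unfolding poly_prod
      by (rule prod.cong) (simp_all add: p_def q_def w_def x_def g_def b_def d_def
          power2_eq_square field_simps)
    finally show ?thesis
      unfolding poly_mult poly_power by (simp add: w_def algebra_simps)
  qed
  then have "[:- ?c, 1:] ^ ?n * char_poly ?M = [:- ?c, 1:] ^ ?m * ?P"
    by (rule poly_eq_if_eq_above)
  \<comment> \<open>The common power is cancelled between polynomials, where it is nonzero;
    pointwise, \<open>w\<close> may vanish.\<close>
  also have "\<dots> = [:- ?c, 1:] ^ ?n * ([:- ?c, 1:] ^ (?m - ?n) * ?P)"
    using nm by (simp only: mult.assoc[symmetric] power_add[symmetric] le_add_diff_inverse)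
  finally show ?thesis
    by (subst (asm) mult_cancel_left) simp
qed

theorem theorem10:
  fixes G :: "'a ugraph" and r n m :: nat and \<alpha> :: real
    and vs :: "'a list" and ws :: "('a + 'a set) list"
    and ev :: "nat \<Rightarrow> real"
  assumes "regular_graph r G" and "r > 1"
    and "n = card (vertices G)" and "m = card (edges G)"
    and "0 \<le> \<alpha>" and "\<alpha> \<le> 1"
    and "enumerates vs (vertices G)"
    and "enumerates ws (vertices (total_graph G))"
    and "eigenvalues (A_alpha \<alpha> G vs) = {#ev i. i \<in># mset_set {1..n}#}"
  shows "eigenvalues (A_alpha \<alpha> (total_graph G) ws) =
    replicate_mset (m - n) (2 * \<alpha> * (real r + 1) - 2) +
    (\<Sum>i = 1..n.
      {# 1 / 2 * (2 * (\<alpha> + ev i - 1) + real r * (\<alpha> + 1)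
           + sqrt ((\<alpha> - 1) * (\<alpha> * (real r + 2)\<^sup>2 - (real r)\<^sup>2 - 4 * (1 + ev i)))),
         1 / 2 * (2 * (\<alpha> + ev i - 1) + real r * (\<alpha> + 1)
           - sqrt ((\<alpha> - 1) * (\<alpha> * (real r + 2)\<^sup>2 - (real r)\<^sup>2 - 4 * (1 + ev i)))) #})"
proof -
  let ?c = "2 * \<alpha> * (real r + 1) - 2"
  define b where "b = (\<lambda>i. 2 * (\<alpha> + ev i - 1) + r * (\<alpha> + 1))"
  define d where "d = (\<lambda>i. (\<alpha> - 1) * (\<alpha> * (real r + 2)\<^sup>2 - (real r)\<^sup>2 - 4 * (1 + ev i)))"
  define Q where "Q = (\<lambda>i. [:((b i)\<^sup>2 - d i) / 4, - b i, 1:])"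
  have G: "simple_graph G" using assms(1) by (simp add: regular_graph_def)
  obtain es where "set es = edges G" "distinct es"
    using finite_distinct_list[OF finite_edges[OF G]] by blast
  then have es: "enumerates es (edges G)" by (simp add: enumerates_def)
  have lvs: "length vs = n" and les: "length es = m"
    using assms(3,4,7) es by (auto simp: enumerates_def distinct_card[symmetric])
  have ws': "enumerates (map Inl vs @ map Inr es) (vertices (total_graph G))"
    using assms(7) es by (auto simp: enumerates_def total_graph_def distinct_map Plus_def)
  have lws: "length ws = n + m"
  proof -
    have "length ws = length (map Inl vs @ map Inr es)"
      using assms(8) ws' by (metis distinct_card enumerates_def)
    then show ?thesis using lvs les by simp
  qed
  \<comment> \<open>The eigenvalues determine the characteristic polynomial because that of a real
    symmetric matrix splits over the reals.\<close>
  have "char_poly (A_alpha \<alpha> G vs) = (\<Prod>x\<in>#eigenvalues (A_alpha \<alpha> G vs). [:- x, 1:])"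
    by (rule char_poly_eq_prod_eigenvalues[OF A_alpha_carrier size_eigenvalues_A_alpha])
  also have "\<dots> = (\<Prod>i = 1..n. [:- ev i, 1:])"
    by (simp add: assms(9) image_mset.compositionality o_def prod_unfold_prod_mset)
  finally have cp: "char_poly (A_alpha \<alpha> G vs) = (\<Prod>i = 1..n. [:- ev i, 1:])" .
  have "char_poly (A_alpha \<alpha> (total_graph G) ws)
      = [:- ?c, 1:] ^ (m - n) * (\<Prod>i = 1..n. Q i)"
    using char_poly_total_graph[OF assms(1,2,5,6,7) es cp]
      char_poly_A_alpha_enumerates[OF ws' assms(8)]
    by (simp only: lvs les Q_def b_def d_def)
  moreover have "Q i \<noteq> 0" for i by (simp add: Q_def)
  ultimately have spec: "eigenvalues (A_alpha \<alpha> (total_graph G) ws)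
      = replicate_mset (m - n) ?c + (\<Sum>i = 1..n. proots (Q i))"
    unfolding eigenvalues_def
    by (simp only:) (subst proots_mult; simp add: proots_power proots_prod)
  have le: "size (proots (Q i)) \<le> 2" for i
    using size_proots_le[of "Q i"] by (simp add: Q_def)
  have "n + m = (m - n) + (\<Sum>i = 1..n. size (proots (Q i)))"
    using size_eigenvalues_A_alpha[of \<alpha> "total_graph G" ws]
    by (simp add: spec lws size_sum_mset_image)
  \<comment> \<open>Counting roots gives \<open>d i \<ge> 0\<close>: the characteristic polynomial splits, hence so does each
    quadratic factor.\<close>
  then have "2 * n \<le> (\<Sum>i = 1..n. size (proots (Q i)))"
    using regular_card_vertices_le_edges[OF assms(1,2)] assms(3,4) by simp
  \<comment> \<open>No quadratic has more than two roots, so a single one without roots would push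
    the total below 2 n.\<close>
  moreover have "(\<Sum>i = 1..n. size (proots (Q i))) < (\<Sum>i = 1..n. 2)"
    if "i \<in> {1..n}" "proots (Q i) = {#}" for i
    using that le by (intro sum_strict_mono_ex1 ballI bexI[of _ i]) auto
  ultimately have "proots (Q i) \<noteq> {#}" if "i \<in> {1..n}" for i
    using that by fastforce
  then have "(\<Sum>i = 1..n. proots (Q i))
      = (\<Sum>i = 1..n. {#1 / 2 * (b i + sqrt (d i)), 1 / 2 * (b i - sqrt (d i))#})"
    unfolding Q_def by (intro sum.cong refl proots_quadratic)
  then show ?thesis unfolding spec by (simp only: b_def d_def)
qed

end
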